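(* Let $p\in[1,\infty)$. For $b=(b_n)_{n=0}^\infty$ belonging to any one of the spaces $\ell^1(w_p)$ or $d_{pp}\cap\ell^1$ or $d_1$, it is the case, for $N\to\infty$, that $$\Big\|b-\sum_{n=0}^N b_ne_n\Big\|_{\mathscr{M}(d_p)}\to0.$$ Equivalently, $$\Big\|T_b-\sum_{n=0}^N b_nS^n\Big\|_{\mathscr{M}_{\mathrm{op}}(d_p)}\to0.$$
   Context: Let $\mathbb{N}_0=\{0,1,2,\dots\}$ and $\ell^1=\ell^1(\mathbb{N}_0)$ (complex sequences). For $p\in[1,\infty)$, $d_p$ is the Banach space of all complex sequences $a=(a_n)_{n=0}^\infty$ with $\|a\|_{d_p}:=\big(\sum_{n=0}^\infty\sup_{k\ge n}|a_k|^p\big)^{1/p}<\infty$. The convolution of $a,b\in\mathbb{C}^{\mathbb{N}_0}$ is $(a*b)_n:=\sum_{j=0}^n a_jb_{n-j}$, $n\in\mathbb{N}_0$. The multiplier algebra of $d_p$ is $\mathscr{M}(d_p):=\{b\in\mathbb{C}^{\mathbb{N}_0}: a*b\in d_p \text{ for all } a\in d_p\}$, normed by $\|b\|_{\mathscr{M}(d_p)}:=\sup_{0\ne a\in d_p}\|a*b\|_{d_p}/\|a\|_{d_p}$. For $b\in\mathscr{M}(d_p)$, $T_b$ is the (automatically bounded) operator $T_b(a):=a*b$ on $d_p$; $\mathscr{M}_{\mathrm{op}}(d_p):=\{T_b:b\in\mathscr{M}(d_p)\}$ carries the operator norm $\|\cdot\|_{\mathscr{M}_{\mathrm{op}}(d_p)}$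 of bounded linear operators on $d_p$. $S$ is the right-shift $S(a_0,a_1,\dots)=(0,a_0,a_1,\dots)$ on $d_p$, and $e_n:=(\delta_{n,k})_{k=0}^\infty$ are the canonical vectors. $\ell^1(w_p)$ is the space of complex sequences $a$ with $\sum_{n=0}^\infty(n+1)^{1/p}|a_n|<\infty$. $d_{pp}$ is the space of complex sequences $a$ with $\sum_{n=0}^\infty 2^{np}\sup_{2^n\le k<2^{n+1}}|a_k|^p<\infty$. Each of the spaces $\ell^1(w_p)$, $d_{pp}\cap\ell^1$, $d_1$ is contained in $\mathscr{M}(d_p)$. *)

theory Defs
  imports "HOL-Analysis.Analysis"
begin

type_synonym cseq = "nat \<Rightarrow> complex"

(* Real-valued suprema and infinite sums carry no information when they diverge,
   so finiteness of the norm is spelled out as finiteness of all the suprema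
   together with summability. *)
definition dp :: "real \<Rightarrow> cseq set" where
  "dp p = {a. bdd_above (range (\<lambda>k. cmod (a k) powr p)) \<and>
              summable (\<lambda>n. SUP k\<in>{n..}. cmod (a k) powr p)}"

definition dp_norm :: "real \<Rightarrow> cseq \<Rightarrow> real" where
  "dp_norm p a = (\<Sum>n. SUP k\<in>{n..}. cmod (a k) powr p) powr (1 / p)"

definition seq_conv :: "cseq \<Rightarrow> cseq \<Rightarrow> cseq" where
  "seq_conv a b n = (\<Sum>j\<le>n. a j * b (n - j))"

definition dp_multipliers :: "real \<Rightarrow> cseq set" where
  "dp_multipliers p = {b. \<forall>a\<in>dp p. seq_conv a b \<in> dp p}"

(* The supremum is finite for b in dp_multipliers p (closed graph theorem);
   the value is meaningful only for such b. *)
definition multiplier_norm :: "real \<Rightarrow> cseq \<Rightarrow> real" where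
  "multiplier_norm p b =
     (SUP a\<in>dp p - {\<lambda>_. 0}. dp_norm p (seq_conv a b) / dp_norm p a)"

(* Operators on dp p are represented by maps on all sequences; only their values
   on dp p matter. The value is meaningful only for bounded linear operators
   from dp p to itself. *)
definition dp_op_norm :: "real \<Rightarrow> (cseq \<Rightarrow> cseq) \<Rightarrow> real" where
  "dp_op_norm p T = (SUP a\<in>dp p - {\<lambda>_. 0}. dp_norm p (T a) / dp_norm p a)"

definition conv_op :: "cseq \<Rightarrow> cseq \<Rightarrow> cseq" where
  "conv_op b = (\<lambda>a. seq_conv a b)"

definition right_shift :: "cseq \<Rightarrow> cseq" where
  "right_shift a n = (case n of 0 \<Rightarrow> 0 | Suc m \<Rightarrow> a m)"

definition unit_seq :: "nat \<Rightarrow> cseq" where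
  "unit_seq n k = (if k = n then 1 else 0)"

definition ell1 :: "cseq set" where
  "ell1 = {a. summable (\<lambda>n. cmod (a n))}"

definition ell1_weighted :: "real \<Rightarrow> cseq set" where
  "ell1_weighted p = {a. summable (\<lambda>n. (real n + 1) powr (1 / p) * cmod (a n))}"

(* The suprema are over finite nonempty index sets; a 0 is unconstrained. *)
definition dpp :: "real \<Rightarrow> cseq set" where
  "dpp p = {a. summable (\<lambda>n. 2 powr (real n * p) *
                 (SUP k\<in>{2 ^ n..<2 ^ (n + 1)}. cmod (a k) powr p))}"

end

theory Submission imports Defs begin

text \<open>
  Both assertions say that convolution with the tail \<open>b - (\<Sum>n\<le>N. b n * unit_seq n)\<close> has operator norm
  tending to \<open>0\<close>: the operator \<open>a \<mapsto> T_b a - (\<Sum>n\<le>N. b n * S ^^ n a)\<close> is convolution with that tail.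
  So it suffices to bound the norm of convolution with \<open>t\<close> by quantities that tend to \<open>0\<close> along the
  tails of \<open>b\<close>; the same bounds, applied to \<open>b\<close> itself, show that \<open>b\<close> is a multiplier.

  For \<open>ell1_weighted p\<close> the bound is the weighted norm of \<open>t\<close> (\<open>conv_bound_weighted\<close>). It reflects that
  a shift by \<open>n\<close> steps has norm \<open>(n + 1) powr (1 / p)\<close> on \<open>dp p\<close>; Jensen's inequality with the weights
  \<open>(n + 1) powr (1 / p) * \<bar>t n\<bar>\<close> takes the place of an infinite triangle inequality and gives an
  explicit summable majorant of the convolution.

  For \<open>dpp p \<inter> ell1\<close> the bound combines the \<open>ell1\<close> norm and the dyadic norm of \<open>t\<close>
  (\<open>conv_bound_dyadic\<close>): in \<open>(\<Sum>j\<le>k. a j * t (k - j))\<close> the terms with \<open>j \<ge> k / 2\<close> see only late, hence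
  small, values of \<open>a\<close>, and the terms with \<open>j < k / 2\<close> see values of \<open>t\<close> from at most two dyadic blocks.
  Finally \<open>dp 1\<close> is contained in \<open>dpp p \<inter> ell1\<close> by Cauchy condensation (\<open>dp1_dyadic_majorant\<close>).
  In each case the bounding series for the tails tend to \<open>0\<close> by dominated convergence.
\<close>

section \<open>Inequalities for sums and series\<close>

text \<open>Jensen's inequality for \<open>x powr p\<close> with weights that need not add up to \<open>1\<close>. Convexity is
  used on the open half-line only, so the terms with weight or value zero are dropped first.\<close>

lemma sum_powr_le_weighted:
  fixes w x :: "'i \<Rightarrow> real"
  assumes "finite S" "1 \<le> p" and w: "\<And>i. i \<in> S \<Longrightarrow> 0 \<le> w i" and x: "\<And>i. i \<in> S \<Longrightarrow> 0 \<le> x i"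
  shows "(\<Sum>i\<in>S. w i * x i) powr p \<le> (\<Sum>i\<in>S. w i) powr (p - 1) * (\<Sum>i\<in>S. w i * x i powr p)"
proof -
  define R where "R = {i\<in>S. 0 < w i \<and> 0 < x i}"
  define W where "W = (\<Sum>i\<in>R. w i)"
  have R: "finite R" "R \<subseteq> S" using assms by (auto simp: R_def)
  have eq: "(\<Sum>i\<in>S. w i * x i) = (\<Sum>i\<in>R. w i * x i)"
    by (rule sum.mono_neutral_right) (use R assms in \<open>force simp: R_def\<close>)+
  show ?thesis
  proof (cases "R = {}")
    case True
    then show ?thesis using eq w by (simp add: sum_nonneg)
  next
    case False
    have W: "W > 0" unfolding W_def using R False by (intro sum_pos) (auto simp: R_def)
    have "(\<Sum>i\<in>R. (w i / W) *\<^sub>R x i) powr p \<le> (\<Sum>i\<in>R. w i / W * x i powr p)"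
      using R False W
      by (intro convex_on_sum[OF _ _ powr_convex[OF \<open>1 \<le> p\<close>]])
         (auto simp: R_def W_def simp flip: sum_divide_distrib)
    then have "((\<Sum>i\<in>R. w i * x i) / W) powr p \<le> (\<Sum>i\<in>R. w i * x i powr p) / W"
      by (simp add: sum_divide_distrib)
    moreover have "W powr p = W * W powr (p - 1)"
      using W by (simp add: powr_mult_base)
    ultimately have "(\<Sum>i\<in>R. w i * x i) powr p \<le> W powr (p - 1) * (\<Sum>i\<in>R. w i * x i powr p)"
      using W by (simp add: powr_divide field_simps)
    also have "\<dots> \<le> (\<Sum>i\<in>S. w i) powr (p - 1) * (\<Sum>i\<in>S. w i * x i powr p)"
      using R assms W
      by (intro mult_mono powr_mono2) (auto simp: W_def intro!: sum_mono2 sum_nonneg)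
    finally show ?thesis using eq by simp
  qed
qed

text \<open>The least majorant of a convolution will be dominated by a superposition \<open>m \<mapsto> (\<Sum>n. f m n)\<close> of
  simple profiles; this is the exchange of summations that bounds its total mass.\<close>

lemma double_series_bound:
  fixes f :: "nat \<Rightarrow> nat \<Rightarrow> real"
  assumes f: "\<And>m n. 0 \<le> f m n" and U: "\<And>M n. (\<Sum>m<M. f m n) \<le> U n" and "summable U"
  shows "summable (\<lambda>n. f m n)"
    and "summable (\<lambda>m. \<Sum>n. f m n)"
    and "(\<Sum>m. \<Sum>n. f m n) \<le> suminf U"
proof -
  have sm: "summable (\<lambda>n. f m n)" for m
  proof (rule summable_comparison_test'[OF \<open>summable U\<close>])
    fix n
    have "f m n \<le> (\<Sum>m<Suc m. f m n)" by (simp add: f sum_nonneg)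
    then show "norm (f m n) \<le> U n" using U[where M = "Suc m" and n = n] f by (simp add: order_trans)
  qed
  then show "summable (\<lambda>n. f m n)" .
  have part: "(\<Sum>m<M. \<Sum>n. f m n) \<le> suminf U" for M
  proof -
    have "(\<Sum>m<M. \<Sum>n. f m n) = (\<Sum>n. \<Sum>m<M. f m n)" by (simp add: suminf_sum sm)
    also have "\<dots> \<le> suminf U" by (intro suminf_le U summable_sum sm \<open>summable U\<close>)
    finally show ?thesis .
  qed
  show s: "summable (\<lambda>m. \<Sum>n. f m n)"
    by (rule summableI_nonneg_bounded[OF _ part]) (simp add: suminf_nonneg f sm)
  show "(\<Sum>m. \<Sum>n. f m n) \<le> suminf U"
    by (rule suminf_le_const[OF s part])
qed

lemma truncated_series_tendsto_0:
  fixes f :: "nat \<Rightarrow> real"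
  assumes "summable f" "\<And>n. 0 \<le> f n" and "\<And>n. \<forall>\<^sub>F N in sequentially. P N n"
  shows "(\<lambda>N. \<Sum>n. if P N n then 0 else f n) \<longlonglongrightarrow> 0"
proof -
  have "(\<lambda>N. \<Sum>n. if P N n then 0 else f n) \<longlonglongrightarrow> (\<Sum>n. 0 :: real)"
  proof (rule tannerys_theorem[THEN conjunct2, THEN conjunct2])
    show "(\<lambda>N. if P N n then 0 else f n) \<longlonglongrightarrow> 0" for n
      by (rule tendsto_eventually) (use assms(3)[of n] in eventually_elim, simp)
    show "\<forall>\<^sub>F (n, N) in sequentially \<times>\<^sub>F sequentially. norm (if P N n then 0 else f n) \<le> f n"
      by (rule always_eventually) (use assms in auto)
  qed (use assms in auto)
  then show ?thesis by simp
qed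

section \<open>The least decreasing majorant\<close>

text \<open>The \<open>p\<close>-th power of the least decreasing majorant of \<open>\<bar>a\<bar>\<close>: keeping the power avoids taking
  roots inside the sums.\<close>

definition dp_majorant :: "real \<Rightarrow> cseq \<Rightarrow> nat \<Rightarrow> real" where
  "dp_majorant p a n = (SUP k\<in>{n..}. cmod (a k) powr p)"

lemma dp_majorant_bdd:
  assumes "a \<in> dp p" shows "bdd_above ((\<lambda>k. cmod (a k) powr p) ` {n..})"
  using assms unfolding dp_def by (auto elim: bdd_above_mono)

lemma dp_majorant_upper: "a \<in> dp p \<Longrightarrow> n \<le> k \<Longrightarrow> cmod (a k) powr p \<le> dp_majorant p a n"
  unfolding dp_majorant_def by (rule cSUP_upper[OF _ dp_majorant_bdd]) auto

lemma dp_majorant_nonneg: "a \<in> dp p \<Longrightarrow> 0 \<le> dp_majorant p a n"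
  using dp_majorant_upper[of a p n n] powr_ge_zero[of "cmod (a n)" p] by linarith

lemma dp_majorant_antimono: "a \<in> dp p \<Longrightarrow> m \<le> n \<Longrightarrow> dp_majorant p a n \<le> dp_majorant p a m"
  unfolding dp_majorant_def[of p a n] by (rule cSUP_least) (auto intro: dp_majorant_upper)

lemma summable_dp_majorant: "a \<in> dp p \<Longrightarrow> summable (dp_majorant p a)"
  by (simp add: dp_def dp_majorant_def[abs_def])

lemma dp_norm_eq_majorant: "dp_norm p a = suminf (dp_majorant p a) powr (1 / p)"
  by (simp add: dp_norm_def dp_majorant_def[abs_def])

text \<open>Exhibiting any summable sequence that dominates all later terms settles both membership in
  \<open>dp p\<close> and the norm, because the least such sequence is the one used in the definition.\<close>

lemma dpI_majorized:
  assumes g: "\<And>n k. n \<le> k \<Longrightarrow> cmod (c k) powr p \<le> g n" and "summable g"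
  shows "c \<in> dp p" "suminf (dp_majorant p c) \<le> suminf g"
proof -
  have maj: "dp_majorant p c n \<le> g n" for n
    unfolding dp_majorant_def by (rule cSUP_least) (auto intro: g)
  have bdd: "bdd_above (range (\<lambda>k. cmod (c k) powr p))"
    by (rule bdd_aboveI2[of _ _ "g 0"]) (simp add: g)
  have pos: "0 \<le> dp_majorant p c n" for n
  proof -
    have "cmod (c n) powr p \<le> dp_majorant p c n"
      unfolding dp_majorant_def by (rule cSUP_upper) (auto intro: bdd_above_mono[OF bdd])
    then show ?thesis using powr_ge_zero order_trans by blast
  qed
  have sm: "summable (dp_majorant p c)"
    by (rule summable_comparison_test'[OF \<open>summable g\<close>, of 0]) (use maj pos in auto)
  show "c \<in> dp p"
    using sm bdd by (simp add: dp_def dp_majorant_def[abs_def])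
  show "suminf (dp_majorant p c) \<le> suminf g"
    by (rule suminf_le[OF maj sm \<open>summable g\<close>])
qed

lemma dp_norm_le_majorized:
  assumes "1 \<le> p" "0 \<le> K"
    and g: "\<And>n k. n \<le> k \<Longrightarrow> cmod (c k) powr p \<le> g n" and "summable g"
    and le: "suminf g \<le> K powr p * suminf (dp_majorant p a)"
  shows "dp_norm p c \<le> K * dp_norm p a"
proof -
  note c = dpI_majorized[where c = c and p = p, OF g \<open>summable g\<close>]
  have "0 \<le> suminf (dp_majorant p c)"
    using c(1) by (intro suminf_nonneg summable_dp_majorant dp_majorant_nonneg)
  then have "dp_norm p c \<le> (K powr p * suminf (dp_majorant p a)) powr (1 / p)"
    unfolding dp_norm_eq_majorant using c(2) le assms(1) by (intro powr_mono2) auto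
  also have "\<dots> = K * dp_norm p a"
    using assms by (simp add: powr_mult powr_powr dp_norm_eq_majorant)
  finally show ?thesis .
qed

section \<open>Two bounds for convolution operators\<close>

lemma seq_conv_commute: "seq_conv a t k = (\<Sum>i\<le>k. t i * a (k - i))"
  unfolding seq_conv_def
  by (rule sum.reindex_bij_witness[of _ "\<lambda>i. k - i" "\<lambda>i. k - i"]) (auto simp: mult.commute)

text \<open>Delaying a decreasing sequence by \<open>i\<close> steps repeats its first term \<open>i\<close> times; this is why
  \<open>S ^^ i\<close> has norm \<open>(i + 1) powr (1 / p)\<close> and where the weight of \<open>ell1_weighted\<close> comes from.\<close>

lemma sum_delayed_majorant_le:
  assumes "a \<in> dp p"
  shows "(\<Sum>m<M. dp_majorant p a (m - i)) \<le> (real i + 1) * suminf (dp_majorant p a)"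
proof -
  let ?d = "dp_majorant p a"
  note d = dp_majorant_nonneg[OF assms]
  have part: "sum ?d I \<le> suminf ?d" if "finite I" for I
    by (rule sum_le_suminf[OF summable_dp_majorant[OF assms] that]) (simp add: d)
  have "(\<Sum>m<M. ?d (m - i)) \<le> (\<Sum>m\<in>{..<i} \<union> {i..<i+M}. ?d (m - i))"
    by (rule sum_mono2) (auto simp: d)
  also have "\<dots> = (\<Sum>m<i. ?d (m - i)) + (\<Sum>m\<in>{i..<i+M}. ?d (m - i))"
    by (rule sum.union_disjoint) auto
  also have "(\<Sum>m<i. ?d (m - i)) = real i * ?d 0" by simp
  also have "(\<Sum>m\<in>{i..<i+M}. ?d (m - i)) = (\<Sum>m<M. ?d m)"
    by (rule sum.reindex_bij_witness[of _ "\<lambda>m. m + i" "\<lambda>m. m - i"]) auto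
  also have "real i * ?d 0 + (\<Sum>m<M. ?d m) \<le> real i * suminf ?d + suminf ?d"
    using part[of "{0}"] part[of "{..<M}"] by (intro add_mono mult_left_mono) auto
  finally show ?thesis by (simp add: algebra_simps)
qed

text \<open>The convolution is a superposition of delayed copies of \<open>a\<close>. Jensen's inequality, with the
  weights normalized by \<open>W\<close>, passes to \<open>p\<close>-th powers termwise, where the delay by \<open>i\<close> costs a factor
  \<open>i + 1\<close> that is divided out by having put \<open>(i + 1) powr (1 / p)\<close> into the weight.\<close>

lemma conv_bound_weighted:
  assumes p: "1 \<le> p" and a: "a \<in> dp p"
    and sw: "summable (\<lambda>n. (real n + 1) powr (1 / p) * cmod (t n))"
  defines "W \<equiv> \<Sum>n. (real n + 1) powr (1 / p) * cmod (t n)"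
  shows "seq_conv a t \<in> dp p" "dp_norm p (seq_conv a t) \<le> W * dp_norm p a"
proof -
  define w where "w n = (real n + 1) powr (1 / p) * cmod (t n)" for n
  let ?d = "dp_majorant p a"
  let ?A = "suminf ?d"
  have sw': "summable w" and W: "W = suminf w" using sw by (simp_all add: w_def[abs_def] W_def)
  have w0: "0 \<le> w n" for n by (simp add: w_def)
  have W0: "0 \<le> W" unfolding W by (rule suminf_nonneg[OF sw' w0])
  note d0 = dp_majorant_nonneg[OF a]
  \<comment> \<open>Truncated subtraction is intended: for \<open>m < i\<close> the delayed majorant still has its first value.\<close>
  define f where "f m i = W powr (p - 1) * (w i / (real i + 1) * ?d (m - i))" for m i
  define U where "U i = W powr (p - 1) * ?A * w i" for i
  have f0: "0 \<le> f m i" for m i by (simp add: f_def w0 d0)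
  have fU: "(\<Sum>m<M. f m i) \<le> U i" for M i
  proof -
    have "(\<Sum>m<M. f m i) = W powr (p - 1) * (w i / (real i + 1) * (\<Sum>m<M. ?d (m - i)))"
      by (simp add: f_def sum_distrib_left)
    also have "\<dots> \<le> W powr (p - 1) * (w i / (real i + 1) * ((real i + 1) * ?A))"
      by (intro mult_left_mono sum_delayed_majorant_le a) (auto simp: w0)
    also have "\<dots> = U i" by (simp add: U_def)
    finally show ?thesis .
  qed
  have sU: "summable U" unfolding U_def by (intro summable_mult sw')
  have sumU: "suminf U = W powr p * ?A"
    using W0 sw' by (simp add: U_def[abs_def] suminf_mult W[symmetric] powr_mult_base mult.assoc)
      (metis add.commute diff_add_cancel mult.commute powr_mult_base)
  note ds = double_series_bound[OF f0 fU sU]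
  have maj: "cmod (seq_conv a t k) powr p \<le> (\<Sum>i. f n i)" if "n \<le> k" for n k
  proof -
    define x where "x i = (real i + 1) powr (- 1 / p) * cmod (a (k - i))" for i
    have "cmod (seq_conv a t k) \<le> (\<Sum>i\<le>k. cmod (t i) * cmod (a (k - i)))"
      unfolding seq_conv_commute by (rule order_trans[OF norm_sum]) (simp add: norm_mult)
    also have "\<dots> = (\<Sum>i\<le>k. w i * x i)"
      by (rule sum.cong) (simp_all add: w_def x_def powr_minus field_simps)
    finally have "cmod (seq_conv a t k) powr p \<le> (\<Sum>i\<le>k. w i * x i) powr p"
      using p by (intro powr_mono2) auto
    also have "\<dots> \<le> (\<Sum>i\<le>k. w i) powr (p - 1) * (\<Sum>i\<le>k. w i * x i powr p)"
      by (rule sum_powr_le_weighted) (use p w0 in \<open>auto simp: x_def\<close>)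
    also have "\<dots> \<le> W powr (p - 1) * (\<Sum>i\<le>k. w i / (real i + 1) * ?d (n - i))"
    proof (rule mult_mono, goal_cases)
      case 1
      have "(\<Sum>i\<le>k. w i) \<le> W" unfolding W by (rule sum_le_suminf[OF sw']) (auto simp: w0)
      then show ?case using p w0 by (intro powr_mono2) (auto intro: sum_nonneg)
    next
      case 2
      show ?case
      proof (rule sum_mono)
        fix i
        have "((real i + 1) powr (- 1 / p)) powr p = inverse (real i + 1)"
          using p by (subst powr_powr) (simp add: powr_minus)
        then have "x i powr p = cmod (a (k - i)) powr p / (real i + 1)"
          by (simp only: x_def powr_mult) (simp add: field_simps)
        also have "\<dots> \<le> ?d (n - i) / (real i + 1)"
          using that by (intro divide_right_mono dp_majorant_upper a) auto
        finally show "w i * x i powr p \<le> w i / (real i + 1) * ?d (n - i)"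
          using mult_left_mono[OF _ w0] by fastforce
      qed
    qed (use w0 in \<open>auto intro!: sum_nonneg\<close>)
    also have "\<dots> = (\<Sum>i\<le>k. f n i)" by (simp add: f_def sum_distrib_left)
    also have "\<dots> \<le> (\<Sum>i. f n i)" by (rule sum_le_suminf[OF ds(1)]) (auto simp: f0)
    finally show ?thesis .
  qed
  show "seq_conv a t \<in> dp p" by (rule dpI_majorized(1)[OF maj ds(2)])
  show "dp_norm p (seq_conv a t) \<le> W * dp_norm p a"
    using ds(3) sumU by (intro dp_norm_le_majorized[OF p W0 maj ds(2)]) auto
qed

text \<open>The blocks start at \<open>2 ^ 0 = 1\<close>, so \<open>t 0\<close> is unconstrained, as it is in \<open>dpp\<close>.\<close>

definition dyadic_majorant :: "real \<Rightarrow> (nat \<Rightarrow> real) \<Rightarrow> cseq \<Rightarrow> bool" where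
  "dyadic_majorant p \<gamma> t \<longleftrightarrow> summable \<gamma> \<and> (\<forall>l. 0 \<le> \<gamma> l) \<and>
     (\<forall>l k. 2 ^ l \<le> k \<and> k < 2 ^ (l + 1) \<longrightarrow> 2 powr (real l * p) * cmod (t k) powr p \<le> \<gamma> l)"

text \<open>Here \<open>\<gamma>\<close> dominates \<open>t\<close> on dyadic blocks, scaled as in \<open>dpp\<close>. Each product \<open>t i * a (k - i)\<close>
  has \<open>k - i \<ge> k / 2\<close> or \<open>i > k / 2\<close>. The products of the first kind are controlled by the
  majorant of \<open>a\<close> at \<open>k div 2\<close> and the \<open>ell1\<close> norm of \<open>t\<close>. In those of the second kind, for \<open>k\<close> in the
  \<open>l\<close>-th dyadic block, \<open>i\<close> lies in block \<open>l\<close> or \<open>l - 1\<close>, and the remaining sum of at most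
  \<open>2 ^ l\<close> values of \<open>\<bar>a\<bar>\<close> is estimated by its \<open>p\<close>-th powers. The resulting bound for the
  block is summed over all \<open>n < 2 ^ (l + 1)\<close>, the positions whose suprema can see the block.\<close>

lemma conv_bound_dyadic:
  assumes p: "1 \<le> p" and a: "a \<in> dp p"
    and st: "summable (\<lambda>n. cmod (t n))" and dyadic: "dyadic_majorant p \<gamma> t"
  defines "K \<equiv> 2 * (2 * (\<Sum>n. cmod (t n)) powr p + 2 * (1 + 2 * 2 powr p) * suminf \<gamma>) powr (1 / p)"
  shows "seq_conv a t \<in> dp p" "dp_norm p (seq_conv a t) \<le> K * dp_norm p a"
proof -
  have s\<gamma>: "summable \<gamma>" and \<gamma>0: "\<And>l. 0 \<le> \<gamma> l"
    and \<gamma>: "\<And>l k. 2 ^ l \<le> k \<Longrightarrow> k < 2 ^ (l + 1) \<Longrightarrow> 2 powr (real l * p) * cmod (t k) powr p \<le> \<gamma> l"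
    using dyadic unfolding dyadic_majorant_def by blast+
  let ?d = "dp_majorant p a"
  define A where "A = suminf ?d"
  define T where "T = (\<Sum>n. cmod (t n))"
  define \<delta> where "\<delta> l = \<gamma> l + 2 powr p * \<gamma> (l - 1)" for l
  note d0 = dp_majorant_nonneg[OF a] and sd = summable_dp_majorant[OF a]
  have A0: "0 \<le> A" unfolding A_def by (rule suminf_nonneg[OF sd d0])
  have T0: "0 \<le> T" unfolding T_def by (rule suminf_nonneg[OF st]) simp
  have \<delta>0: "0 \<le> \<delta> l" for l by (simp add: \<delta>_def \<gamma>0)
  have s\<gamma>': "summable (\<lambda>l. \<gamma> (l - 1))"
    by (subst summable_Suc_iff[symmetric]) (simp add: s\<gamma>)
  have s\<delta>: "summable \<delta>" unfolding \<delta>_def by (intro summable_add summable_mult s\<gamma> s\<gamma>')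
  have \<delta>_le: "suminf \<delta> \<le> (1 + 2 * 2 powr p) * suminf \<gamma>"
  proof -
    have "(\<Sum>l. \<gamma> (l - 1)) = \<gamma> 0 + suminf \<gamma>"
      using suminf_split_head[OF s\<gamma>'] by simp
    moreover have "\<gamma> 0 \<le> suminf \<gamma>"
      using sum_le_suminf[OF s\<gamma>, of "{0}"] \<gamma>0 by simp
    ultimately have "(\<Sum>l. \<gamma> (l - 1)) \<le> 2 * suminf \<gamma>" by simp
    moreover have "suminf \<delta> = suminf \<gamma> + 2 powr p * (\<Sum>l. \<gamma> (l - 1))"
      unfolding \<delta>_def suminf_mult[OF s\<gamma>', symmetric]
      by (rule suminf_add[symmetric]) (intro s\<gamma> s\<gamma>' summable_mult)+
    ultimately show ?thesis
      using mult_left_mono[of _ _ "2 powr p"] by (fastforce simp: algebra_simps)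
  qed

  \<comment> \<open>The majorant of the products with \<open>k - i \<ge> k / 2\<close>: each value of \<open>dp_majorant p a\<close> occurs twice.\<close>
  define g1 where "g1 n = T powr p * ?d (n div 2)" for n
  have g1U: "(\<Sum>n<M. g1 n) \<le> 2 * T powr p * A" for M
  proof -
    have "(\<Sum>n<M. g1 n) \<le> (\<Sum>n<2 * M. g1 n)"
      by (rule sum_mono2) (auto simp: g1_def d0)
    also have "\<dots> = 2 * T powr p * (\<Sum>n<M. ?d n)"
      by (induction M) (simp_all add: g1_def algebra_simps)
    also have "\<dots> \<le> 2 * T powr p * A"
      unfolding A_def by (intro mult_left_mono sum_le_suminf[OF sd]) (auto simp: d0)
    finally show ?thesis .
  qed
  have g10: "0 \<le> g1 n" for n by (simp add: g1_def d0)
  have sg1: "summable g1" by (rule summableI_nonneg_bounded[OF g10 g1U])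
  have sumg1: "suminf g1 \<le> 2 * T powr p * A" by (rule suminf_le_const[OF sg1 g1U])

  \<comment> \<open>The majorant of the products with \<open>i > k / 2\<close>, as a superposition over the dyadic blocks.\<close>
  define f where "f n l = (if n < 2 ^ (l + 1) then A * \<delta> l / 2 ^ l else 0)" for n l :: nat
  have f0: "0 \<le> f n l" for n l by (simp add: f_def A0 \<delta>0)
  have fU: "(\<Sum>n<M. f n l) \<le> 2 * A * \<delta> l" for M l
  proof -
    have "(\<Sum>n<M. f n l) = (\<Sum>n\<in>{..<M} \<inter> {..<2 ^ (l + 1)}. A * \<delta> l / 2 ^ l)"
      by (rule sum.mono_neutral_cong_right) (auto simp: f_def)
    also have "\<dots> \<le> (\<Sum>n<2 ^ (l + 1) :: nat. A * \<delta> l / 2 ^ l)"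
      by (rule sum_mono2) (auto simp: A0 \<delta>0)
    finally show ?thesis by simp
  qed
  define g2 where "g2 n = (\<Sum>l. f n l)" for n
  note ds = double_series_bound[OF f0 fU summable_mult[OF s\<delta>]]
  have sumg2: "suminf g2 \<le> 2 * A * ((1 + 2 * 2 powr p) * suminf \<gamma>)"
  proof -
    have "suminf g2 \<le> 2 * A * suminf \<delta>"
      using ds(3) s\<delta> by (simp add: g2_def[abs_def] suminf_mult)
    also have "\<dots> \<le> 2 * A * ((1 + 2 * 2 powr p) * suminf \<gamma>)"
      using \<delta>_le A0 by (intro mult_left_mono) auto
    finally show ?thesis .
  qed
  have sg2: "summable g2" using ds(2) by (simp add: g2_def[abs_def])
  have g20: "0 \<le> g2 n" for n unfolding g2_def by (intro suminf_nonneg ds(1) f0)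

  have maj: "cmod (seq_conv a t k) powr p \<le> 2 powr p * (g1 n + g2 n)" if nk: "n \<le> k" for n k
  proof -
    define J where "J = {j. j \<le> k \<and> k \<le> 2 * j}"
    define L where "L = {j. 2 * j < k}"
    have fin: "finite J" "finite L"
      by (auto simp: J_def L_def intro: finite_subset[of _ "{..k}"])
    have JL: "{..k} = J \<union> L" "J \<inter> L = {}" by (auto simp: J_def L_def)
    define P where "P = (\<Sum>j\<in>J. cmod (a j) * cmod (t (k - j)))"
    define Q where "Q = (\<Sum>j\<in>L. cmod (a j) * cmod (t (k - j)))"
    have P0: "0 \<le> P" and Q0: "0 \<le> Q" by (simp_all add: P_def Q_def sum_nonneg)
    have PQ: "cmod (seq_conv a t k) \<le> P + Q"
      unfolding seq_conv_def JL(1) P_def Q_def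
      by (subst sum.union_disjoint[OF fin JL(2), symmetric])
         (rule order_trans[OF norm_sum], simp add: norm_mult)

    have Pg: "P powr p \<le> g1 n"
    proof -
      define D where "D = ?d (n div 2) powr (1 / p)"
      have "cmod (a j) \<le> D" if "j \<in> J" for j
      proof -
        have "cmod (a j) powr p \<le> ?d (n div 2)"
          using that nk by (intro dp_majorant_upper a) (auto simp: J_def)
        then have "(cmod (a j) powr p) powr (1 / p) \<le> D"
          unfolding D_def using p by (intro powr_mono2) auto
        then show ?thesis using p by (simp add: powr_powr)
      qed
      then have "P \<le> (\<Sum>j\<in>J. D * cmod (t (k - j)))"
        unfolding P_def by (intro sum_mono mult_right_mono) auto
      also have "\<dots> = D * (\<Sum>i\<in>(\<lambda>j. k - j) ` J. cmod (t i))"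
        by (subst sum.reindex) (auto simp: inj_on_def J_def sum_distrib_left)
      also have "\<dots> \<le> D * T"
        unfolding T_def D_def using fin by (intro mult_left_mono sum_le_suminf[OF st]) auto
      finally have "P powr p \<le> (D * T) powr p" using p P0 by (intro powr_mono2) auto
      also have "\<dots> = g1 n"
        using p d0 by (simp add: powr_mult D_def powr_powr g1_def)
      finally show ?thesis .
    qed

    have Qg: "Q powr p \<le> g2 n"
    proof (cases "k = 0")
      case True
      then show ?thesis using g20 by (simp add: Q_def L_def)
    next
      case False
      then obtain l where l: "2 ^ l \<le> k" "k < 2 ^ (l + 1)"
        using ex_power_ivl1[of 2 k] by auto
      define B where "B = \<delta> l powr (1 / p) / 2 ^ l"
      have tB: "cmod (t (k - j)) \<le> B" if "j \<in> L" for j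
      proof -
        have "2 powr (real l * p) * cmod (t (k - j)) powr p \<le> \<delta> l"
        proof (cases "2 ^ l \<le> k - j")
          case True
          then have "2 powr (real l * p) * cmod (t (k - j)) powr p \<le> \<gamma> l"
            using l by (intro \<gamma>) auto
          then show ?thesis using \<gamma>0[of "l - 1"] unfolding \<delta>_def by (smt (verit) mult_nonneg_nonneg powr_ge_zero)
        next
          case False
          then have "l \<noteq> 0" using that l by (auto simp: L_def intro!: Nat.gr0I)
          then obtain l' where l': "l = Suc l'" using not0_implies_Suc by blast
          have "2 powr (real l' * p) * cmod (t (k - j)) powr p \<le> \<gamma> l'"
            using l that False unfolding l' by (intro \<gamma>) (auto simp: L_def)
          then have "2 powr p * (2 powr (real l' * p) * cmod (t (k - j)) powr p) \<le> 2 powr p * \<gamma> l'"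
            by (intro mult_left_mono) auto
          moreover have "2 powr (real l * p) = 2 powr p * 2 powr (real l' * p)"
            by (simp add: l' algebra_simps flip: powr_add)
          moreover have "\<delta> l = \<gamma> l + 2 powr p * \<gamma> l'" by (simp add: \<delta>_def l')
          ultimately show ?thesis using \<gamma>0[of l] by (simp only: mult.assoc)
        qed
        moreover have "2 powr (real l * p) = (2 ^ l) powr p"
          by (simp add: powr_powr flip: powr_realpow)
        ultimately have "((2 ^ l * cmod (t (k - j))) powr p) powr (1 / p) \<le> \<delta> l powr (1 / p)"
          using p by (intro powr_mono2) (auto simp: powr_mult)
        then show ?thesis using p by (simp add: powr_powr B_def field_simps)
      qed
      have B0: "0 \<le> B" by (simp add: B_def)
      have L: "L \<subseteq> {..<2 ^ l}" using l by (auto simp: L_def)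
      have "Q \<le> (\<Sum>j\<in>L. cmod (a j) * B)"
        unfolding Q_def by (intro sum_mono mult_left_mono tB) auto
      also have "\<dots> \<le> (\<Sum>j<2 ^ l. cmod (a j) * B)"
        using L B0 by (intro sum_mono2) auto
      also have "\<dots> = B * (\<Sum>j<2 ^ l. 1 * cmod (a j))"
        by (simp add: sum_distrib_left mult.commute)
      finally have "Q powr p \<le> (B * (\<Sum>j<2 ^ l. 1 * cmod (a j))) powr p"
        using p Q0 by (intro powr_mono2) auto
      also have "\<dots> = B powr p * (\<Sum>j<2 ^ l. 1 * cmod (a j)) powr p"
        by (simp add: powr_mult)
      also have "\<dots> \<le> B powr p * ((\<Sum>j<2 ^ l :: nat. 1) powr (p - 1) * (\<Sum>j<2 ^ l. 1 * cmod (a j) powr p))"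
        using p by (intro mult_left_mono sum_powr_le_weighted) auto
      also have "\<dots> \<le> B powr p * ((2 ^ l) powr (p - 1) * A)"
      proof -
        have "(\<Sum>j<2 ^ l. cmod (a j) powr p) \<le> (\<Sum>j<2 ^ l. ?d j)"
          by (intro sum_mono dp_majorant_upper a) auto
        also have "\<dots> \<le> A" unfolding A_def by (rule sum_le_suminf[OF sd]) (auto simp: d0)
        finally show ?thesis by (intro mult_left_mono) auto
      qed
      also have "\<dots> = A * \<delta> l / 2 ^ l"
        using p \<delta>0[of l] by (simp add: B_def powr_divide powr_powr powr_diff)
      also have "\<dots> = f n l" using nk l by (simp add: f_def)
      also have "\<dots> \<le> g2 n"
        using sum_le_suminf[OF ds(1)[of n], of "{l}"] f0 by (simp add: g2_def)
      finally show ?thesis .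
    qed

    have "cmod (seq_conv a t k) powr p \<le> (2 * max P Q) powr p"
      using PQ p P0 Q0 by (intro powr_mono2) auto
    also have "\<dots> = 2 powr p * max P Q powr p" by (simp add: powr_mult)
    also have "\<dots> \<le> 2 powr p * (P powr p + Q powr p)"
      by (intro mult_left_mono) (auto simp: max_def)
    also have "\<dots> \<le> 2 powr p * (g1 n + g2 n)"
      using Pg Qg by (intro mult_left_mono add_mono) auto
    finally show ?thesis .
  qed
  have K0: "0 \<le> K" by (simp add: K_def)
  have C0: "0 \<le> 2 * T powr p + 2 * (1 + 2 * 2 powr p) * suminf \<gamma>"
    using suminf_nonneg[OF s\<gamma> \<gamma>0] by simp
  have "(\<Sum>n. 2 powr p * (g1 n + g2 n)) = 2 powr p * (suminf g1 + suminf g2)"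
    by (simp add: suminf_mult suminf_add[symmetric] summable_add sg1 sg2)
  also have "\<dots> \<le> 2 powr p * (2 * T powr p * A + 2 * A * ((1 + 2 * 2 powr p) * suminf \<gamma>))"
    by (intro mult_left_mono add_mono sumg1 sumg2) auto
  also have "\<dots> = 2 powr p * (2 * T powr p + 2 * (1 + 2 * 2 powr p) * suminf \<gamma>) * A"
    by (simp add: algebra_simps)
  also have "\<dots> = K powr p * A"
    using p C0 unfolding K_def T_def[symmetric] by (simp add: powr_mult powr_powr)
  finally have le: "(\<Sum>n. 2 powr p * (g1 n + g2 n)) \<le> K powr p * suminf ?d"
    by (simp add: A_def)
  have sg: "summable (\<lambda>n. 2 powr p * (g1 n + g2 n))" by (intro summable_mult summable_add sg1 sg2)
  show "dp_norm p (seq_conv a t) \<le> K * dp_norm p a"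
    by (rule dp_norm_le_majorized[OF p K0 maj sg le])
  show "seq_conv a t \<in> dp p" by (rule dpI_majorized(1)[OF maj sg])
qed

section \<open>Existence of dyadic majorants\<close>

lemma dpp_dyadic_majorant:
  assumes "b \<in> dpp p"
  shows "\<exists>\<gamma>. dyadic_majorant p \<gamma> b"
proof -
  define s where "s l = (SUP k\<in>{2 ^ l..<2 ^ (l + 1)}. cmod (b k) powr p)" for l :: nat
  have up: "cmod (b k) powr p \<le> s l" if "2 ^ l \<le> k" "k < 2 ^ (l + 1)" for l k
    unfolding s_def using that by (intro cSUP_upper) auto
  have "0 \<le> s l" for l by (rule order_trans[OF powr_ge_zero up[of l "2 ^ l"]]) auto
  moreover have "summable (\<lambda>l. 2 powr (real l * p) * s l)"
    using assms by (simp add: dpp_def s_def)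
  ultimately have "dyadic_majorant p (\<lambda>l. 2 powr (real l * p) * s l) b"
    by (auto simp: dyadic_majorant_def intro!: up)
  then show ?thesis by blast
qed

text \<open>By Cauchy condensation a decreasing summable sequence \<open>\<beta>\<close> has \<open>2 ^ l * \<beta> (2 ^ l)\<close> summable, and
  the \<open>p\<close>-th powers of a summable sequence are summable. This places \<open>dp 1\<close> inside \<open>dpp p\<close>.\<close>

lemma dp1_dyadic_majorant:
  assumes "1 \<le> p" and b: "b \<in> dp 1"
  shows "\<exists>\<gamma>. dyadic_majorant p \<gamma> b"
proof -
  define x where "x l = 2 ^ l * dp_majorant 1 b (2 ^ l)" for l :: nat
  note d0 = dp_majorant_nonneg[OF b]
  have sx: "summable x"
    using summable_dp_majorant[OF b] unfolding x_def
    by (subst condensation_test[symmetric]) (auto simp: d0 intro: dp_majorant_antimono[OF b])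
  have x0: "0 \<le> x l" for l by (simp add: x_def d0)
  have "\<forall>\<^sub>F l in sequentially. x l < 1"
    using summable_LIMSEQ_zero[OF sx] by (rule order_tendstoD) simp
  then have "\<forall>\<^sub>F l in sequentially. norm (x l powr p) \<le> x l"
  proof eventually_elim
    case (elim l)
    then show ?case using powr_mono'[of 1 p "x l"] assms x0[of l] by simp
  qed
  then have "summable (\<lambda>l. x l powr p)" by (rule summable_comparison_test_ev[OF _ sx])
  moreover have "2 powr (real l * p) * cmod (b k) powr p \<le> x l powr p" if "2 ^ l \<le> k" for l k
  proof -
    have "cmod (b k) \<le> dp_majorant 1 b (2 ^ l)"
      using dp_majorant_upper[OF b that] by simp
    then have "(2 ^ l * cmod (b k)) powr p \<le> x l powr p"
      unfolding x_def using assms by (intro powr_mono2 mult_left_mono) auto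
    moreover have "2 powr (real l * p) = (2 ^ l) powr p"
      by (simp add: powr_powr flip: powr_realpow)
    ultimately show ?thesis by (simp add: powr_mult)
  qed
  ultimately have "dyadic_majorant p (\<lambda>l. x l powr p) b" by (simp add: dyadic_majorant_def)
  then show ?thesis by blast
qed

lemma dp1_subset_ell1: "dp 1 \<subseteq> ell1"
proof
  fix b assume b: "b \<in> dp 1"
  show "b \<in> ell1" unfolding ell1_def
    using dp_majorant_upper[OF b order_refl]
    by (auto intro!: summable_comparison_test'[OF summable_dp_majorant[OF b], of 0])
qed

section \<open>Tails as multipliers\<close>

abbreviation tail :: "nat \<Rightarrow> cseq \<Rightarrow> cseq" where
  "tail N b \<equiv> \<lambda>k. if k \<le> N then 0 else b k"

lemma minus_partial_sum_unit_seq: "(\<lambda>k. b k - (\<Sum>n=0..N. b n * unit_seq n k)) = tail N b"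
proof
  fix k
  have "(\<Sum>n=0..N. b n * unit_seq n k) = (\<Sum>n=0..N. if n = k then b n else 0)"
    by (rule sum.cong) (auto simp: unit_seq_def)
  then show "b k - (\<Sum>n=0..N. b n * unit_seq n k) = tail N b k" by simp
qed

lemma right_shift_funpow: "(right_shift ^^ n) a k = (if n \<le> k then a (k - n) else 0)"
  by (induction n arbitrary: k) (auto simp: right_shift_def split: nat.split)

lemma conv_op_minus_partial_sum_shifts:
  "(\<lambda>a k. conv_op b a k - (\<Sum>n=0..N. b n * (right_shift ^^ n) a k)) = conv_op (tail N b)"
proof (intro ext)
  fix a k
  have "(\<Sum>n=0..N. b n * (right_shift ^^ n) a k) = (\<Sum>n\<le>k. if n \<le> N then b n * a (k - n) else 0)"
    by (rule sum.mono_neutral_cong) (auto simp: right_shift_funpow)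
  then show "conv_op b a k - (\<Sum>n=0..N. b n * (right_shift ^^ n) a k) = conv_op (tail N b) a k"
    unfolding conv_op_def seq_conv_commute
    by (simp only: sum_subtractf[symmetric]) (rule sum.cong, auto)
qed

lemma unit_seq_in_dp: "unit_seq 0 \<in> dp p"
proof (rule dpI_majorized(1))
  show "cmod (unit_seq 0 k) powr p \<le> (if n = 0 then 1 else 0)" if "n \<le> k" for n k
    using that by (simp add: unit_seq_def)
qed auto

text \<open>A real supremum over an empty or unbounded set would say nothing about its members, so the lower
  bound needs both the upper bound \<open>K\<close> and a nonzero element of \<open>dp p\<close>.\<close>

lemma multiplier_norm_bounds:
  assumes "0 \<le> K" and "\<And>a. a \<in> dp p \<Longrightarrow> dp_norm p (seq_conv a t) \<le> K * dp_norm p a"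
  shows "0 \<le> multiplier_norm p t" "multiplier_norm p t \<le> K"
proof -
  let ?q = "\<lambda>a. dp_norm p (seq_conv a t) / dp_norm p a"
  have q: "?q a \<le> K" "0 \<le> ?q a" if "a \<in> dp p" for a
    using assms(1) assms(2)[OF that] by (auto simp: dp_norm_def divide_le_eq)
  have e: "unit_seq 0 \<in> dp p - {\<lambda>_. 0}"
    using unit_seq_in_dp by (auto simp: unit_seq_def fun_eq_iff)
  have "?q (unit_seq 0) \<le> multiplier_norm p t" unfolding multiplier_norm_def
    by (rule cSUP_upper[OF e]) (rule bdd_aboveI2[where M = K], rule q, simp)
  with q(2)[of "unit_seq 0"] e show "0 \<le> multiplier_norm p t" by simp
  show "multiplier_norm p t \<le> K" unfolding multiplier_norm_def
  proof (rule cSUP_least)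
    show "dp p - {\<lambda>_. 0} \<noteq> {}" using e by blast
    show "?q a \<le> K" if "a \<in> dp p - {\<lambda>_. 0}" for a using that q(1) by simp
  qed
qed

lemma multiplier_norm_tendsto_0:
  assumes "\<And>N. 0 \<le> K N" "K \<longlonglongrightarrow> 0"
    and "\<And>N a. a \<in> dp p \<Longrightarrow> dp_norm p (seq_conv a (t N)) \<le> K N * dp_norm p a"
  shows "(\<lambda>N. multiplier_norm p (t N)) \<longlonglongrightarrow> 0"
  by (rule tendsto_sandwich[OF always_eventually always_eventually tendsto_const \<open>K \<longlonglongrightarrow> 0\<close>])
     (rule allI, rule multiplier_norm_bounds[OF assms(1,3)], assumption)+

lemma weighted_multiplier:
  assumes p: "1 \<le> p" and b: "b \<in> ell1_weighted p"
  shows "b \<in> dp_multipliers p" "(\<lambda>N. multiplier_norm p (tail N b)) \<longlonglongrightarrow> 0"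
proof -
  let ?w = "\<lambda>b n. (real n + 1) powr (1 / p) * cmod (b n)"
  have s: "summable (?w b)" using b by (simp add: ell1_weighted_def)
  show "b \<in> dp_multipliers p"
    by (auto simp: dp_multipliers_def intro: conv_bound_weighted(1)[OF p _ s])
  have eq: "?w (tail N b) = (\<lambda>n. if n \<le> N then 0 else ?w b n)" for N by auto
  have st: "summable (?w (tail N b))" for N
    by (rule summable_comparison_test'[OF s, of 0]) auto
  show "(\<lambda>N. multiplier_norm p (tail N b)) \<longlonglongrightarrow> 0"
  proof (rule multiplier_norm_tendsto_0)
    show "(\<lambda>N. suminf (?w (tail N b))) \<longlonglongrightarrow> 0"
      unfolding eq by (rule truncated_series_tendsto_0[OF s]) (auto simp: eventually_ge_at_top)
    show "0 \<le> suminf (?w (tail N b))" for N by (rule suminf_nonneg[OF st]) simp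
  qed (rule conv_bound_weighted(2)[OF p _ st])
qed

lemma dyadic_multiplier:
  assumes p: "1 \<le> p" and b: "b \<in> ell1" and \<gamma>: "dyadic_majorant p \<gamma> b"
  shows "b \<in> dp_multipliers p" "(\<lambda>N. multiplier_norm p (tail N b)) \<longlonglongrightarrow> 0"
proof -
  have s: "summable (\<lambda>n. cmod (b n))" using b by (simp add: ell1_def)
  have s\<gamma>: "summable \<gamma>" and \<gamma>0: "0 \<le> \<gamma> l" for l using \<gamma> by (auto simp: dyadic_majorant_def)
  show "b \<in> dp_multipliers p"
    by (auto simp: dp_multipliers_def intro: conv_bound_dyadic(1)[OF p _ s \<gamma>])
  have eq: "(\<lambda>n. cmod (tail N b n)) = (\<lambda>n. if n \<le> N then 0 else cmod (b n))" for N by auto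
  have st: "summable (\<lambda>n. cmod (tail N b n))" for N
    by (rule summable_comparison_test'[OF s, of 0]) auto
  \<comment> \<open>A dyadic block on which the tail vanishes needs no majorant.\<close>
  define \<gamma>' where "\<gamma>' N l = (if 2 ^ (l + 1) \<le> N then 0 else \<gamma> l)" for N l :: nat
  have \<gamma>'0: "0 \<le> \<gamma>' N l" for N l by (simp add: \<gamma>'_def \<gamma>0)
  have s\<gamma>': "summable (\<gamma>' N)" for N
    by (rule summable_comparison_test'[OF s\<gamma>, of 0]) (auto simp: \<gamma>'_def \<gamma>0)
  have \<gamma>': "dyadic_majorant p (\<gamma>' N) (tail N b)" for N
    using \<gamma> s\<gamma>' \<gamma>'0 unfolding dyadic_majorant_def by (auto simp: \<gamma>'_def)
  define K where "K N = 2 * (2 * (\<Sum>n. cmod (tail N b n)) powr p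
      + 2 * (1 + 2 * 2 powr p) * suminf (\<gamma>' N)) powr (1 / p)" for N
  show "(\<lambda>N. multiplier_norm p (tail N b)) \<longlonglongrightarrow> 0"
  proof (rule multiplier_norm_tendsto_0)
    have T: "(\<lambda>N. \<Sum>n. cmod (tail N b n)) \<longlonglongrightarrow> 0"
      unfolding eq by (rule truncated_series_tendsto_0[OF s]) (auto simp: eventually_ge_at_top)
    have G: "(\<lambda>N. suminf (\<gamma>' N)) \<longlonglongrightarrow> 0"
      unfolding \<gamma>'_def by (rule truncated_series_tendsto_0[OF s\<gamma> \<gamma>0]) (rule eventually_ge_at_top)
    have pos: "0 \<le> (\<Sum>n. cmod (tail N b n))" for N by (rule suminf_nonneg[OF st]) simp
    have "(\<lambda>N. (\<Sum>n. cmod (tail N b n)) powr p) \<longlonglongrightarrow> 0"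
      using p pos by (intro tendsto_zero_powrI[OF T tendsto_const]) auto
    then have "(\<lambda>N. 2 * (\<Sum>n. cmod (tail N b n)) powr p
        + 2 * (1 + 2 * 2 powr p) * suminf (\<gamma>' N)) \<longlonglongrightarrow> 0"
      by (intro tendsto_add_zero tendsto_mult_right_zero G)
    then have "(\<lambda>N. (2 * (\<Sum>n. cmod (tail N b n)) powr p
        + 2 * (1 + 2 * 2 powr p) * suminf (\<gamma>' N)) powr (1 / p)) \<longlonglongrightarrow> 0"
      using p suminf_nonneg[OF s\<gamma>' \<gamma>'0] by (intro tendsto_zero_powrI[OF _ tendsto_const]) auto
    then show "K \<longlonglongrightarrow> 0" unfolding K_def by (rule tendsto_mult_right_zero)
    show "0 \<le> K N" for N by (simp add: K_def)
  qed (unfold K_def, rule conv_bound_dyadic(2)[OF p _ st \<gamma>'])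
qed

theorem corollary5p5:
  fixes p :: real and b :: "nat \<Rightarrow> complex"
  assumes "1 \<le> p"
    and "b \<in> ell1_weighted p \<or> b \<in> dpp p \<inter> ell1 \<or> b \<in> dp 1"
  shows "b \<in> dp_multipliers p
    \<and> (\<lambda>N. multiplier_norm p (\<lambda>k. b k - (\<Sum>n=0..N. b n * unit_seq n k))) \<longlonglongrightarrow> 0
    \<and> (\<lambda>N. dp_op_norm p (\<lambda>a k. conv_op b a k - (\<Sum>n=0..N. b n * (right_shift ^^ n) a k))) \<longlonglongrightarrow> 0"
proof -
  have "b \<in> dp_multipliers p \<and> (\<lambda>N. multiplier_norm p (tail N b)) \<longlonglongrightarrow> 0"
    using assms(2)
  proof (elim disjE)
    assume "b \<in> ell1_weighted p"
    then show ?thesis using weighted_multiplier[OF assms(1)] by simp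
  next
    assume "b \<in> dpp p \<inter> ell1"
    then obtain \<gamma> where "dyadic_majorant p \<gamma> b" "b \<in> ell1" using dpp_dyadic_majorant by blast
    then show ?thesis using dyadic_multiplier[OF assms(1)] by simp
  next
    assume "b \<in> dp 1"
    then obtain \<gamma> where "dyadic_majorant p \<gamma> b" "b \<in> ell1"
      using dp1_dyadic_majorant[OF assms(1)] dp1_subset_ell1 by blast
    then show ?thesis using dyadic_multiplier[OF assms(1)] by simp
  qed
  moreover have "dp_op_norm p (conv_op t) = multiplier_norm p t" for t
    by (simp add: dp_op_norm_def multiplier_norm_def conv_op_def)
  ultimately show ?thesis
    by (simp only: minus_partial_sum_unit_seq conv_op_minus_partial_sum_shifts simp_thms)
qed

end
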